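(* Let $F_t\colon Y^\phi\to Y^\phi$ be the Gibbs–Markov semiflow associated with a nonuniformly expanding semiflow of order $p\in[2,\infty]$. Suppose that $v\colon Y^\phi\to\mathbb{R}^N$ satisfies condition $(\star)$, let $m,\chi\colon Y^\phi\to\mathbb{R}^N$ be its martingale part and coboundary part, and define $\psi=\int_0^1v\circ F_s\,ds$. Then $\psi=m+\chi\circ F_1-\chi$ and $m\in\ker L_1$.
   Context: Setting. Let $(M,d)$ be a bounded metric space, $\{\Psi_t\}_{t\ge0}$ a semiflow on $M$ with, for some $K,L>0$, $d(\Psi_tx,\Psi_ty)\le Kd(x,y)$ for $t\in[0,1]$ and $d(\Psi_tx,\Psi_sx)\le L|t-s|$ for $t,s\ge0$. Let $X\subset M$ be Borel with first return time $r\colon X\to[1,\infty)$, $r(x)=\inf\{t>0:\Psi_tx\in X\}$, $r$ bounded and $\eta$-Hölder, $\eta\in(0,1]$, and $Tx=\Psi_{r(x)}x$. Let $\rho$ be a Borel probability measure on $X$, ergodic and nonsingular for $T$. Let $Y\subset X$ be measurable with $\rho(Y)>0$, $\{Y_j\}_{j\ge1}$ an at most countable measurable partition of $Y$, $\tau\colon Y\to\mathbb{Z}^+$ constant on each $Y_j$ with $\tau\in L^p(Y)$, $T^{\tau(y)}y\in Y$, $Fy=T^{\tau(y)}y$, such that for some $\lambda>1$, $C\ge1$ and all $j$, $y,y'\in Y_j$: (a) $F|_{Y_j}\colon Y_j\to Y$ is a measure-theoretic bijection; (b) $d(Fy,Fy')\ge\lambda d(y,y')$; (c) $d(T^\ell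 y,T^\ell y')\le Cd(Fy,Fy')$ for $0\le\ell\le\tau(y)-1$; (d) $\zeta=d\rho|_Y/(d\rho|_Y\circ F)$ satisfies $|\log\zeta(y)-\log\zeta(y')|\le Cd(Fy,Fy')^\eta$. There is a unique absolutely continuous ergodic $F$-invariant probability measure $\mu$ on $Y$, and $d\mu/d\rho|_Y$ is bounded. Let $\phi(y)=\sum_{j=0}^{\tau(y)-1}r(T^jy)\ge1$, so $\phi\in L^p(Y,\mu)$. The suspension is $Y^\phi=\{(y,u):y\in Y,u\in[0,\phi(y)]\}/\!\sim$, $(y,\phi(y))\sim(Fy,0)$, with semiflow $F_t(y,u)=(y,u+t)$ modulo identifications and invariant probability measure $\mu^\phi=(\mu\times\mathrm{Lebesgue})/\int_Y\phi\,d\mu$. $F_t$ is the Gibbs–Markov semiflow. Transfer operators: $P$ on $L^1(Y,\mu)$ for $F$, $\int(Pv)w\,d\mu=\int v(w\circ F)\,d\mu$; $L_t$ on $L^1(Y^\phi,\mu^\phi)$ for $F_t$, $\int(L_tv)w\,d\mu^\phi=\int v(w\circ F_t)\,d\mu^\phi$ ($w\in L^\infty$); applied componentwise to vector-valued functions. $C^\eta(Y,\mathbb{R}^N)$ has norm $\|w\|_\eta=|w|_\infty+\sup_{y\ne y'}|w(y)-w(y')|/d(y,y')^\eta$. Condition $(\star)$: for $v\colon Y^\phi\to\mathbb{R}^N$ put $v'(y)=\int_0^{\phi(y)}v(y,u)\,du$. Then $v$ satisfies $(\star)$ if $v\in L^\infty(Y^\phi)$, $\int_{Y^\phi}v\,d\mu^\phi=0$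 and $\|Pv'\|_\eta<\infty$. Martingale and coboundary parts: if $v$ satisfies $(\star)$, put $\chi'=\sum_{k=1}^\infty P^kv'$ (which converges in $C^\eta(Y,\mathbb{R}^N)$) and $m'=v'-\chi'\circ F+\chi'$ on $Y$. For $y\in Y$, $u\in[0,\phi(y))$ put $\chi(y,u)=\chi'(y)+\int_0^uv(y,s)\,ds$, and $m(y,u)=m'(y)$ if $u\in[\phi(y)-1,\phi(y))$, $m(y,u)=0$ if $u\in[0,\phi(y)-1)$. *)

theory Defs
  imports "HOL-Probability.Probability"
begin

section \<open>Function spaces and maps of measure spaces\<close>

definition in_Lp ::
  "ennreal \<Rightarrow> 'a measure \<Rightarrow> ('a \<Rightarrow> 'b::{banach, second_countable_topology}) \<Rightarrow> bool" where
  "in_Lp p M f \<longleftrightarrow> f \<in> borel_measurable M \<and>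
     (if p = \<infinity> then \<exists>c. AE x in M. norm (f x) \<le> c
      else integrable M (\<lambda>x. norm (f x) powr enn2real p))"

text \<open>The value is in \<open>[0,\<infinity>]\<close>, so \<open>holder_norm \<eta> S w < \<infinity>\<close> says that \<open>w\<close> is bounded and
  \<open>\<eta>\<close>-Hoelder on \<open>S\<close>.\<close>

definition holder_norm ::
  "real \<Rightarrow> 'a::metric_space set \<Rightarrow> ('a \<Rightarrow> 'b::real_normed_vector) \<Rightarrow> ennreal" where
  "holder_norm \<eta> S w =
     (SUP y\<in>S. ennreal (norm (w y))) +
     (SUP (y, y') \<in> {(y, y'). y \<in> S \<and> y' \<in> S \<and> y \<noteq> y'}.
        ennreal (norm (w y - w y') / dist y y' powr \<eta>))"

definition nonsingular_map :: "'a measure \<Rightarrow> ('a \<Rightarrow> 'a) \<Rightarrow> bool" where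
  "nonsingular_map M f \<longleftrightarrow> f \<in> measurable M M \<and>
     (\<forall>A\<in>null_sets M. f -` A \<inter> space M \<in> null_sets M)"

definition invariant_map :: "'a measure \<Rightarrow> ('a \<Rightarrow> 'a) \<Rightarrow> bool" where
  "invariant_map M f \<longleftrightarrow> f \<in> measurable M M \<and> distr M M f = M"

definition ergodic_map :: "'a measure \<Rightarrow> ('a \<Rightarrow> 'a) \<Rightarrow> bool" where
  "ergodic_map M f \<longleftrightarrow> f \<in> measurable M M \<and>
     (\<forall>A\<in>sets M. f -` A \<inter> space M = A \<longrightarrow> A \<in> null_sets M \<or> space M - A \<in> null_sets M)"

text \<open>A measure-theoretic bijection is a bimeasurable bijection after removal of null sets.\<close>

definition mt_bij_betw :: "'a measure \<Rightarrow> ('a \<Rightarrow> 'a) \<Rightarrow> 'a set \<Rightarrow> 'a set \<Rightarrow> bool" where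
  "mt_bij_betw M f A B \<longleftrightarrow> (\<exists>A' B'.
     A' \<in> sets M \<and> A' \<subseteq> A \<and> A - A' \<in> null_sets M \<and>
     B' \<in> sets M \<and> B' \<subseteq> B \<and> B - B' \<in> null_sets M \<and>
     bij_betw f A' B' \<and>
     f \<in> measurable (restrict_space M A') (restrict_space M B') \<and>
     the_inv_into A' f \<in> measurable (restrict_space M B') (restrict_space M A'))"

text \<open>\<open>\<zeta> = dM / d(M \<circ> f)\<close> on a set \<open>A\<close> on which \<open>f\<close> is injective, where \<open>(M \<circ> f)(E) = M (f ` E)\<close>
  for \<open>E \<subseteq> A\<close>. Transported by \<open>f\<close>, the integral of \<open>\<zeta>\<close> over \<open>E\<close> with respect to \<open>M \<circ> f\<close> is the
  integral below. Images of measurable sets need only be measurable up to null sets, hence the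
  restriction on \<open>E\<close>.\<close>

definition is_inverse_jacobian ::
  "'a measure \<Rightarrow> ('a \<Rightarrow> 'a) \<Rightarrow> 'a set \<Rightarrow> ('a \<Rightarrow> real) \<Rightarrow> bool" where
  "is_inverse_jacobian M f A \<zeta> \<longleftrightarrow>
     \<zeta> \<in> borel_measurable (restrict_space M A) \<and> (\<forall>y\<in>A. 0 < \<zeta> y) \<and>
     (\<forall>E\<in>sets M. E \<subseteq> A \<and> f ` E \<in> sets M \<longrightarrow>
        emeasure M E = (\<integral>\<^sup>+z\<in>f ` E. ennreal (\<zeta> (the_inv_into A f z)) \<partial>M))"

text \<open>Elements of \<open>L\<^sup>1\<close> are represented by functions, so the transfer operator of \<open>f\<close> is given as a
  relation: \<open>w\<close> is a version of the image of \<open>v\<close>. Versions agree almost everywhere.\<close>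

definition is_transfer :: "'a measure \<Rightarrow> ('a \<Rightarrow> 'a) \<Rightarrow> ('a \<Rightarrow> real) \<Rightarrow> ('a \<Rightarrow> real) \<Rightarrow> bool" where
  "is_transfer M f v w \<longleftrightarrow> integrable M v \<and> integrable M w \<and>
     (\<forall>g::'a \<Rightarrow> real. in_Lp \<infinity> M g \<longrightarrow>
        (\<integral>x. w x * g x \<partial>M) = (\<integral>x. v x * g (f x) \<partial>M))"

definition is_transfer_vec ::
  "'a measure \<Rightarrow> ('a \<Rightarrow> 'a) \<Rightarrow> ('a \<Rightarrow> real^'n) \<Rightarrow> ('a \<Rightarrow> real^'n) \<Rightarrow> bool" where
  "is_transfer_vec M f v w \<longleftrightarrow> (\<forall>i. is_transfer M f (\<lambda>x. v x $ i) (\<lambda>x. w x $ i))"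


section \<open>Nonuniformly expanding semiflows\<close>

definition first_return_time :: "(real \<Rightarrow> 'a \<Rightarrow> 'a) \<Rightarrow> 'a set \<Rightarrow> 'a \<Rightarrow> real" where
  "first_return_time \<Psi> X x = Inf {t. 0 < t \<and> \<Psi> t x \<in> X}"

definition first_return_map :: "(real \<Rightarrow> 'a \<Rightarrow> 'a) \<Rightarrow> 'a set \<Rightarrow> 'a \<Rightarrow> 'a" where
  "first_return_map \<Psi> X x = \<Psi> (first_return_time \<Psi> X x) x"

definition induced_map :: "('a \<Rightarrow> 'a) \<Rightarrow> ('a \<Rightarrow> nat) \<Rightarrow> 'a \<Rightarrow> 'a" where
  "induced_map T \<tau> y = (T ^^ \<tau> y) y"

definition induced_roof :: "('a \<Rightarrow> real) \<Rightarrow> ('a \<Rightarrow> 'a) \<Rightarrow> ('a \<Rightarrow> nat) \<Rightarrow> 'a \<Rightarrow> real" where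
  "induced_roof r T \<tau> y = (\<Sum>j<\<tau> y. r ((T ^^ j) y))"

text \<open>The bounded metric space is the whole type \<open>'a\<close>. Nonemptiness of the set of return times is
  required separately because \<open>Inf {}\<close> is an unspecified real. Since return times are at least \<open>1\<close>,
  the infimum is attained, so the first return map sends \<open>X\<close> to \<open>X\<close>.\<close>

locale nonuniformly_expanding_semiflow =
  fixes \<Psi> :: "real \<Rightarrow> 'a::metric_space \<Rightarrow> 'a"
    and K L :: real
    and X :: "'a set"
    and \<eta> :: real
    and \<rho> :: "'a measure"
    and Y :: "'a set"
    and \<Y> :: "'a set set"
    and \<tau> :: "'a \<Rightarrow> nat"
    and p :: ennreal
    and lam C :: real
    and \<zeta> :: "'a \<Rightarrow> real"
    and r :: "'a \<Rightarrow> real"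
    and T F :: "'a \<Rightarrow> 'a"
  assumes bounded_space: "bounded (UNIV :: 'a set)"
    and semiflow_0: "\<And>x. \<Psi> 0 x = x"
    and semiflow_add: "\<And>s t x. 0 \<le> s \<Longrightarrow> 0 \<le> t \<Longrightarrow> \<Psi> (s + t) x = \<Psi> s (\<Psi> t x)"
    and K_pos: "0 < K" and L_pos: "0 < L"
    and lipschitz_space: "\<And>t x y. 0 \<le> t \<Longrightarrow> t \<le> 1 \<Longrightarrow> dist (\<Psi> t x) (\<Psi> t y) \<le> K * dist x y"
    and lipschitz_time: "\<And>s t x. 0 \<le> s \<Longrightarrow> 0 \<le> t \<Longrightarrow> dist (\<Psi> t x) (\<Psi> s x) \<le> L * \<bar>t - s\<bar>"
    and X_borel: "X \<in> sets borel"
    and returns: "\<And>x. x \<in> X \<Longrightarrow> \<exists>t>0. \<Psi> t x \<in> X"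
    and r_eq: "r = first_return_time \<Psi> X"
    and T_eq: "T = first_return_map \<Psi> X"
    and r_ge_1: "\<And>x. x \<in> X \<Longrightarrow> 1 \<le> r x"
    and eta: "0 < \<eta>" "\<eta> \<le> 1"
    and r_holder: "holder_norm \<eta> X r < \<infinity>"
    and rho_prob: "prob_space \<rho>"
    and rho_sets: "sets \<rho> = sets (restrict_space borel X)"
    and rho_nonsingular: "nonsingular_map \<rho> T"
    and rho_ergodic: "ergodic_map \<rho> T"
    and Y_sets: "Y \<in> sets \<rho>"
    and Y_pos: "0 < emeasure \<rho> Y"
    and part: "partition_on Y \<Y>"
    and part_countable: "countable \<Y>"
    and part_sets: "\<And>A. A \<in> \<Y> \<Longrightarrow> A \<in> sets \<rho>"
    and tau_pos: "\<And>y. y \<in> Y \<Longrightarrow> 0 < \<tau> y"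
    and tau_const: "\<And>A y y'. A \<in> \<Y> \<Longrightarrow> y \<in> A \<Longrightarrow> y' \<in> A \<Longrightarrow> \<tau> y = \<tau> y'"
    and order: "2 \<le> p"
    and tau_Lp: "in_Lp p (restrict_space \<rho> Y) (\<lambda>y. real (\<tau> y))"
    and F_eq: "F = induced_map T \<tau>"
    and F_into: "\<And>y. y \<in> Y \<Longrightarrow> F y \<in> Y"
    and lam: "1 < lam" and C: "1 \<le> C"
    and F_bij: "\<And>A. A \<in> \<Y> \<Longrightarrow> mt_bij_betw \<rho> F A Y"
    and F_expand: "\<And>A y y'. A \<in> \<Y> \<Longrightarrow> y \<in> A \<Longrightarrow> y' \<in> A \<Longrightarrow> lam * dist y y' \<le> dist (F y) (F y')"
    and T_backward: "\<And>A y y' l. A \<in> \<Y> \<Longrightarrow> y \<in> A \<Longrightarrow> y' \<in> A \<Longrightarrow> l < \<tau> y \<Longrightarrow>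
          dist ((T ^^ l) y) ((T ^^ l) y') \<le> C * dist (F y) (F y')"
    and zeta_jacobian: "\<And>A. A \<in> \<Y> \<Longrightarrow> is_inverse_jacobian \<rho> F A \<zeta>"
    and zeta_distortion: "\<And>A y y'. A \<in> \<Y> \<Longrightarrow> y \<in> A \<Longrightarrow> y' \<in> A \<Longrightarrow>
          \<bar>ln (\<zeta> y) - ln (\<zeta> y')\<bar> \<le> C * dist (F y) (F y') powr \<eta>"

definition acip_bounded_density ::
  "'a measure \<Rightarrow> 'a set \<Rightarrow> ('a \<Rightarrow> 'a) \<Rightarrow> 'a measure \<Rightarrow> bool" where
  "acip_bounded_density \<rho> Y F \<mu> \<longleftrightarrow>
     prob_space \<mu> \<and> sets \<mu> = sets (restrict_space \<rho> Y) \<and>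
     absolutely_continuous (restrict_space \<rho> Y) \<mu> \<and>
     invariant_map \<mu> F \<and> ergodic_map \<mu> F \<and>
     (\<exists>c::real. AE y in restrict_space \<rho> Y. RN_deriv (restrict_space \<rho> Y) \<mu> y \<le> ennreal c)"


section \<open>The Gibbs--Markov semiflow on the suspension\<close>

text \<open>Every class of \<open>{(y, u). y \<in> Y \<and> 0 \<le> u \<le> \<phi> y} / \<sim>\<close> with \<open>(y, \<phi> y) \<sim> (F y, 0)\<close> has exactly
  one representative with \<open>u < \<phi> y\<close>. The suspension is the set of these representatives, and
  functions on it are functions of type \<open>'a \<times> real \<Rightarrow> _\<close> whose values elsewhere are irrelevant.\<close>

definition suspension :: "'a set \<Rightarrow> ('a \<Rightarrow> real) \<Rightarrow> ('a \<times> real) set" where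
  "suspension Y \<phi> = {(y, u). y \<in> Y \<and> 0 \<le> u \<and> u < \<phi> y}"

definition birkhoff_sum :: "('a \<Rightarrow> 'a) \<Rightarrow> ('a \<Rightarrow> real) \<Rightarrow> nat \<Rightarrow> 'a \<Rightarrow> real" where
  "birkhoff_sum F \<phi> n y = (\<Sum>i<n. \<phi> ((F ^^ i) y))"

text \<open>\<open>(y, u + t)\<close> modulo identifications: its representative is \<open>(F^n y, u + t - \<phi>_n y)\<close> where
  \<open>\<phi>_n\<close> is the Birkhoff sum and \<open>n\<close> satisfies \<open>\<phi>_n y \<le> u + t < \<phi>_(n+1) y\<close>.\<close>

definition suspension_flow ::
  "('a \<Rightarrow> 'a) \<Rightarrow> ('a \<Rightarrow> real) \<Rightarrow> real \<Rightarrow> 'a \<times> real \<Rightarrow> 'a \<times> real" where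
  "suspension_flow F \<phi> t = (\<lambda>(y, u).
     let n = (LEAST n. u + t < birkhoff_sum F \<phi> (Suc n) y)
     in ((F ^^ n) y, u + t - birkhoff_sum F \<phi> n y))"

definition suspension_measure ::
  "'a set \<Rightarrow> 'a measure \<Rightarrow> ('a \<Rightarrow> real) \<Rightarrow> ('a \<times> real) measure" where
  "suspension_measure Y \<mu> \<phi> =
     scale_measure (inverse (ennreal (\<integral>y. \<phi> y \<partial>\<mu>)))
       (restrict_space (\<mu> \<Otimes>\<^sub>M lborel) (suspension Y \<phi>))"


section \<open>Martingale and coboundary parts\<close>

definition fibre_integral :: "('a \<Rightarrow> real) \<Rightarrow> ('a \<times> real \<Rightarrow> real^'n) \<Rightarrow> 'a \<Rightarrow> real^'n" where
  "fibre_integral \<phi> v y = (LBINT u:{0..<\<phi> y}. v (y, u))"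

definition condition_star ::
  "real \<Rightarrow> 'a::metric_space set \<Rightarrow> 'a measure \<Rightarrow> ('a \<Rightarrow> 'a) \<Rightarrow> ('a \<Rightarrow> real) \<Rightarrow>
    ('a \<times> real \<Rightarrow> real^'n) \<Rightarrow> bool" where
  "condition_star \<eta> Y \<mu> F \<phi> v \<longleftrightarrow>
     in_Lp \<infinity> (suspension_measure Y \<mu> \<phi>) v \<and>
     (\<integral>x. v x \<partial>suspension_measure Y \<mu> \<phi>) = 0 \<and>
     (\<exists>w. is_transfer_vec \<mu> F (fibre_integral \<phi> v) w \<and> holder_norm \<eta> Y w < \<infinity>)"

text \<open>\<open>chi' = (\<Sum>k\<ge>1. P^k v')\<close> with convergence in the \<open>\<eta>\<close>-Hoelder norm; \<open>w k\<close> is a version of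
  \<open>P^k v'\<close>, which for \<open>k \<ge> 1\<close> is the Hoelder one.\<close>

definition transfer_series_sums ::
  "real \<Rightarrow> 'a::metric_space set \<Rightarrow> 'a measure \<Rightarrow> ('a \<Rightarrow> 'a) \<Rightarrow>
    ('a \<Rightarrow> real^'n) \<Rightarrow> ('a \<Rightarrow> real^'n) \<Rightarrow> bool" where
  "transfer_series_sums \<eta> Y \<mu> F v' chi' \<longleftrightarrow>
     (\<exists>w. w 0 = v' \<and> (\<forall>k. is_transfer_vec \<mu> F (w k) (w (Suc k))) \<and>
          (\<forall>k\<ge>1. holder_norm \<eta> Y (w k) < \<infinity>) \<and>
          (\<lambda>n. holder_norm \<eta> Y (\<lambda>y. (\<Sum>k=1..n. w k y) - chi' y)) \<longlonglongrightarrow> 0)"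

definition coboundary_part ::
  "('a \<times> real \<Rightarrow> real^'n) \<Rightarrow> ('a \<Rightarrow> real^'n) \<Rightarrow> 'a \<times> real \<Rightarrow> real^'n" where
  "coboundary_part v chi' = (\<lambda>(y, u). chi' y + (LBINT s:{0..u}. v (y, s)))"

definition martingale_base ::
  "('a \<Rightarrow> 'a) \<Rightarrow> ('a \<Rightarrow> real^'n) \<Rightarrow> ('a \<Rightarrow> real^'n) \<Rightarrow> 'a \<Rightarrow> real^'n" where
  "martingale_base F v' chi' y = v' y - chi' (F y) + chi' y"

definition martingale_part ::
  "('a \<Rightarrow> real) \<Rightarrow> ('a \<Rightarrow> real^'n) \<Rightarrow> 'a \<times> real \<Rightarrow> real^'n" where
  "martingale_part \<phi> m' = (\<lambda>(y, u). if \<phi> y - 1 \<le> u \<and> u < \<phi> y then m' y else 0)"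

end

theory Submission
  imports Defs
begin

text \<open>
  The roof satisfies \<open>\<phi> \<ge> 1\<close>, so an orbit of length \<open>1\<close> in the suspension meets the roof at most
  once. Below the roof, \<open>\<psi>(y, u)\<close> is the integral of \<open>v(y, \<cdot>)\<close> over \<open>[u, u + 1]\<close>, which is the
  increment of \<open>chi\<close>. If the roof is met, which happens exactly for \<open>u \<ge> \<phi> y - 1\<close>, then \<open>\<psi>(y, u)\<close> is
  the integral of \<open>v(y, \<cdot>)\<close> over \<open>[u, \<phi> y)\<close> plus that of \<open>v(F y, \<cdot>)\<close> over \<open>[0, u + 1 - \<phi> y]\<close>, and it
  differs from the increment of \<open>chi\<close> by \<open>v' y - chi' (F y) + chi' y = m' y\<close>
  (\<open>time_one_integral_decomposition\<close>). This computation needs \<open>v\<close> to be integrable on the two fibres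
  over \<open>y\<close> and \<open>F y\<close>. Since \<open>v\<close> is essentially bounded and \<open>F\<close> preserves \<open>\<mu>\<close>, this holds for almost
  every \<open>y\<close> (\<open>in_Lp_infinity_suspension_fibres\<close>), and the identity is one almost everywhere.

  For the second claim, the function \<open>m\<close> lives on the strip \<open>u \<in> [\<phi> y - 1, \<phi> y)\<close>, which the time-one
  map carries to \<open>[0, 1)\<close> in the fibre over \<open>F y\<close>. Fubini's theorem therefore turns
  \<open>\<integral> m (g \<circ> F_1)\<close> into a multiple of \<open>\<integral> m' (G \<circ> F) \<partial>\<mu>\<close>, where \<open>G y\<close> is the integral of \<open>g(y, \<cdot>)\<close> over
  \<open>[0, 1)\<close>, so \<open>L_1 m = 0\<close> follows from \<open>P m' = 0\<close> (\<open>transfer_zero_top_strip\<close>). Finally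
  \<open>P m' = P v' - chi' + P chi'\<close> vanishes because \<open>chi' = P v' + P chi'\<close> by the definition of \<open>chi'\<close> as
  a series (\<open>martingale_base_transfer_zero\<close>).

  Both arguments rest on the invariance of the probability measure \<open>\<mu>\<close> under \<open>F\<close> and on the roof \<open>\<phi>\<close>
  being integrable and at least \<open>1\<close>, which makes the normalising constant of the suspension measure
  finite and positive. Integrability holds because \<open>\<phi> \<le> B \<tau>\<close> for a bound \<open>B\<close> of \<open>r\<close>, \<open>\<tau>\<close> is in
  \<open>L^p(\<rho>)\<close>, and \<open>\<mu>\<close> has bounded density (\<open>roof_over_acip\<close>).
\<close>

section \<open>Essentially bounded functions\<close>

lemma in_Lp_infinity_iff:
  fixes f :: "'a \<Rightarrow> 'b::{banach, second_countable_topology}"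
  shows "in_Lp \<infinity> M f \<longleftrightarrow> f \<in> borel_measurable M \<and> (\<exists>c\<ge>0. AE x in M. norm (f x) \<le> c)"
proof -
  have "(\<exists>c. AE x in M. norm (f x) \<le> c) \<longleftrightarrow> (\<exists>c\<ge>0. AE x in M. norm (f x) \<le> c)"
  proof
    assume "\<exists>c. AE x in M. norm (f x) \<le> c"
    then obtain c where "AE x in M. norm (f x) \<le> c" by blast
    then have "AE x in M. norm (f x) \<le> max 0 c" by eventually_elim auto
    then show "\<exists>c\<ge>0. AE x in M. norm (f x) \<le> c" by (intro exI[of _ "max 0 c"]) auto
  qed blast
  then show ?thesis by (simp add: in_Lp_def)
qed

lemma in_Lp_infinity_mult_integrable:
  fixes f h :: "'a \<Rightarrow> real"
  assumes f: "integrable M f" and h: "in_Lp \<infinity> M h"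
  shows "integrable M (\<lambda>x. f x * h x)"
proof -
  obtain c where c: "c \<ge> 0" "AE x in M. norm (h x) \<le> c" and [measurable]: "h \<in> borel_measurable M"
    using h unfolding in_Lp_infinity_iff by blast
  have [measurable]: "f \<in> borel_measurable M" using f by auto
  have dom: "integrable M (\<lambda>x. c * f x)" using f by simp
  have bound: "AE x in M. norm (f x * h x) \<le> norm (c * f x)"
    using c(2)
    by eventually_elim (use c(1) in \<open>auto simp: abs_mult mult.commute[of c] intro!: mult_left_mono\<close>)
  show ?thesis by (rule Bochner_Integration.integrable_bound[OF dom _ bound]) measurable
qed

lemma (in finite_measure) in_Lp_imp_integrable:
  fixes f :: "'a \<Rightarrow> 'b::{banach, second_countable_topology}"
  assumes f: "in_Lp p M f" and p: "1 \<le> p"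
  shows "integrable M f"
proof (cases "p = \<infinity>")
  case True
  then show ?thesis using f by (auto simp: in_Lp_def intro: integrable_const_bound)
next
  case False
  define q where "q = enn2real p"
  have q: "1 \<le> q" using p False unfolding q_def
    by (cases p) (auto simp: ennreal_le_iff2 simp flip: ennreal_1)
  have *: "norm z \<le> norm (1 + norm z powr q)" for z :: 'b
  proof (cases "norm z \<le> 1")
    case True
    then show ?thesis by (auto intro: order_trans[OF _ abs_ge_self] add_increasing2)
  next
    case False
    then have "norm z powr 1 \<le> norm z powr q" using q by (intro powr_mono) auto
    then show ?thesis using False by simp
  qed
  have "integrable M (\<lambda>x. 1 + norm (f x) powr q)" "f \<in> borel_measurable M"
    using f False by (auto simp: in_Lp_def q_def)
  then show ?thesis using * by (auto intro: Bochner_Integration.integrable_bound)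
qed

section \<open>Passing through one roof\<close>

lemma suspension_flow_before_roof:
  "u + t < \<phi> y \<Longrightarrow> suspension_flow F \<phi> t (y, u) = (y, u + t)"
  by (simp add: suspension_flow_def birkhoff_sum_def Least_eq_0)

lemma suspension_flow_past_roof:
  assumes "\<phi> y \<le> u + t" "u + t < \<phi> y + \<phi> (F y)"
  shows "suspension_flow F \<phi> t (y, u) = (F y, u + t - \<phi> y)"
proof -
  have "(LEAST n. u + t < birkhoff_sum F \<phi> (Suc n) y) = 1"
  proof (rule Least_equality)
    show "u + t < birkhoff_sum F \<phi> (Suc 1) y" using assms by (simp add: birkhoff_sum_def)
    show "1 \<le> n" if "u + t < birkhoff_sum F \<phi> (Suc n) y" for n
      using that assms by (cases n) (auto simp: birkhoff_sum_def)
  qed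
  then show ?thesis by (simp add: suspension_flow_def birkhoff_sum_def)
qed

text \<open>The transported set and integrand are characterised by hypotheses, so that both instances needed
  below, translation within a fibre and translation across the roof, match directly.\<close>

lemma set_integral_lborel_translate:
  fixes f g :: "real \<Rightarrow> 'b::{banach, second_countable_topology}"
  assumes "\<And>s. s \<in> B \<longleftrightarrow> c + s \<in> A" "\<And>s. s \<in> B \<Longrightarrow> g s = f (c + s)"
  shows "(LBINT s:B. g s) = (LBINT s:A. f s)"
  unfolding set_lebesgue_integral_def
  by (subst (2) lborel_integral_real_affine[of 1 _ c])
     (auto intro!: Bochner_Integration.integral_cong simp: indicator_def assms)

lemma set_integrable_lborel_translate:
  fixes f g :: "real \<Rightarrow> 'b::{banach, second_countable_topology}"
  assumes "\<And>s. s \<in> B \<longleftrightarrow> c + s \<in> A" "\<And>s. s \<in> B \<Longrightarrow> g s = f (c + s)"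
  shows "set_integrable lborel B g \<longleftrightarrow> set_integrable lborel A f"
  unfolding set_integrable_def
  by (subst (2) lborel_integrable_real_affine_iff[of 1 _ c, symmetric])
     (auto intro!: Bochner_Integration.integrable_cong simp: indicator_def assms)

text \<open>The pointwise identity \<open>\<psi> = m + chi \<circ> F_1 - chi\<close>. The fibre integrability assumptions make the
  integrals additive; the Bochner integral of a non-integrable function is \<open>0\<close>, so additivity would
  fail without them. The function \<open>c\<close> on the base is arbitrary: when the roof is met, it
  contributes \<open>c y - c (F y)\<close> to the martingale part and \<open>c (F y) - c y\<close> to the increment of the
  coboundary part, and otherwise it contributes to neither.\<close>

lemma time_one_integral_decomposition:
  fixes v :: "'a \<times> real \<Rightarrow> real^'n"
  assumes int_y: "set_integrable lborel {0..<\<phi> y} (\<lambda>s. v (y, s))"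
    and int_Fy: "set_integrable lborel {0..<\<phi> (F y)} (\<lambda>s. v (F y, s))"
    and u: "0 \<le> u" "u < \<phi> y" and roof: "1 \<le> \<phi> (F y)"
  shows "(LBINT s:{0..1}. v (suspension_flow F \<phi> s (y, u))) =
    martingale_part \<phi> (martingale_base F (fibre_integral \<phi> v) c) (y, u)
      + coboundary_part v c (suspension_flow F \<phi> 1 (y, u)) - coboundary_part v c (y, u)"
proof -
  \<comment> \<open>The fibre integrals are cut at \<open>u\<close> into intervals that may share this one endpoint.\<close>
  have touch: "AE s in lborel. \<not> (s \<in> I \<and> s \<in> J)" if "I \<inter> J \<subseteq> {u}" for I J
    using AE_lborel_singleton[of u] by eventually_elim (use that in auto)
  show ?thesis
  proof (cases "u + 1 < \<phi> y")
    case True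
    have \<psi>: "(LBINT s:{0..1}. v (suspension_flow F \<phi> s (y, u))) = (LBINT s:{u..u+1}. v (y, s))"
      using True by (intro set_integral_lborel_translate[of _ u])
        (auto simp: suspension_flow_before_roof)
    have "(LBINT s:{0..u} \<union> {u..u+1}. v (y, s)) = (LBINT s:{0..u}. v (y, s)) + (LBINT s:{u..u+1}. v (y, s))"
      using u True by (intro set_integral_Un_AE set_integrable_subset[OF int_y] touch) auto
    also have "{0..u} \<union> {u..u+1} = {0..u+1}" using u by auto
    finally show ?thesis
      using True by (simp add: \<psi> suspension_flow_before_roof coboundary_part_def martingale_part_def)
  next
    case False
    \<comment> \<open>The orbit reaches the roof at time \<open>\<phi> y - u\<close>.\<close>
    let ?h = "\<phi> y - u"
    have int_above: "set_integrable lborel {u..<\<phi> y} (\<lambda>s. v (y, s))"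
      and int_landed: "set_integrable lborel {0..u+1-\<phi> y} (\<lambda>s. v (F y, s))"
      using u roof by (auto intro: set_integrable_subset[OF int_y] set_integrable_subset[OF int_Fy])
    have flow_past: "suspension_flow F \<phi> s (y, u) = (F y, (u - \<phi> y) + s)" if "s \<in> {?h..1}" for s
      using that u roof by (subst suspension_flow_past_roof) auto
    have int_before: "set_integrable lborel {0..<?h} (\<lambda>s. v (suspension_flow F \<phi> s (y, u)))"
      by (rule set_integrable_lborel_translate[of _ u, THEN iffD2, OF _ _ int_above])
        (auto simp: suspension_flow_before_roof)
    have int_past: "set_integrable lborel {?h..1} (\<lambda>s. v (suspension_flow F \<phi> s (y, u)))"
      by (rule set_integrable_lborel_translate[of _ "u - \<phi> y", THEN iffD2, OF _ _ int_landed])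
        (auto simp: flow_past)
    have "(LBINT s:{0..<?h} \<union> {?h..1}. v (suspension_flow F \<phi> s (y, u))) =
      (LBINT s:{0..<?h}. v (suspension_flow F \<phi> s (y, u))) + (LBINT s:{?h..1}. v (suspension_flow F \<phi> s (y, u)))"
      by (intro set_integral_Un int_before int_past) auto
    also have "{0..<?h} \<union> {?h..1} = {0..1}" using u False by auto
    also have "(LBINT s:{0..<?h}. v (suspension_flow F \<phi> s (y, u))) = (LBINT s:{u..<\<phi> y}. v (y, s))"
      by (intro set_integral_lborel_translate[of _ u]) (auto simp: suspension_flow_before_roof)
    also have "(LBINT s:{?h..1}. v (suspension_flow F \<phi> s (y, u))) = (LBINT s:{0..u+1-\<phi> y}. v (F y, s))"
      by (intro set_integral_lborel_translate[of _ "u - \<phi> y"]) (auto simp: flow_past)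
    finally have \<psi>: "(LBINT s:{0..1}. v (suspension_flow F \<phi> s (y, u))) =
      (LBINT s:{u..<\<phi> y}. v (y, s)) + (LBINT s:{0..u+1-\<phi> y}. v (F y, s))" .
    have "(LBINT s:{0..u} \<union> {u..<\<phi> y}. v (y, s)) = (LBINT s:{0..u}. v (y, s)) + (LBINT s:{u..<\<phi> y}. v (y, s))"
      using u by (intro set_integral_Un_AE set_integrable_subset[OF int_y] touch) auto
    also have "{0..u} \<union> {u..<\<phi> y} = {0..<\<phi> y}" using u by auto
    finally have "fibre_integral \<phi> v y = (LBINT s:{0..u}. v (y, s)) + (LBINT s:{u..<\<phi> y}. v (y, s))"
      by (simp add: fibre_integral_def)
    moreover have "suspension_flow F \<phi> 1 (y, u) = (F y, u + 1 - \<phi> y)"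
      using False u by (subst flow_past) auto
    ultimately show ?thesis
      using False u by (simp add: \<psi> coboundary_part_def martingale_part_def martingale_base_def)
  qed
qed

lemma set_integral_unit_interval:
  fixes f :: "real \<Rightarrow> real"
  assumes [measurable]: "f \<in> borel_measurable lborel" and b: "b = a + 1"
    and bound: "AE u in lborel. u \<in> {a..<b} \<longrightarrow> \<bar>f u\<bar> \<le> c"
  shows "set_integrable lborel {a..<b} f" and "\<bar>LBINT u:{a..<b}. f u\<bar> \<le> c"
proof -
  show int: "set_integrable lborel {a..<b} f"
    unfolding set_integrable_def
    by (rule integrableI_bounded_set_indicator[where B = c]) (use bound b in auto)
  have "\<bar>LBINT u:{a..<b}. f u\<bar> \<le> (\<integral>u. norm (indicator {a..<b} u *\<^sub>R f u) \<partial>lborel)"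
    using integral_norm_bound[of lborel "\<lambda>u. indicator {a..<b} u *\<^sub>R f u"]
    by (simp add: set_lebesgue_integral_def)
  also have "\<dots> \<le> (\<integral>u. indicator {a..<b} u * c \<partial>lborel)"
  proof (rule integral_mono_AE)
    show "AE u in lborel. norm (indicator {a..<b} u *\<^sub>R f u) \<le> indicator {a..<b} u * c"
      using bound by eventually_elim (auto simp: indicator_def)
  qed (use int b in \<open>auto simp: set_integrable_def\<close>)
  also have "\<dots> = c" using b by simp
  finally show "\<bar>LBINT u:{a..<b}. f u\<bar> \<le> c" .
qed

section \<open>Hoelder norms\<close>

lemma holder_norm_ge_norm:
  "y \<in> A \<Longrightarrow> ennreal (norm (w y)) \<le> holder_norm \<eta> A w"
  unfolding holder_norm_def by (rule add_increasing2) (auto intro: SUP_upper)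

lemma holder_norm_tendsto_0_imp_uniform_limit:
  assumes "(\<lambda>n. holder_norm \<eta> A (\<lambda>y. f n y - g y)) \<longlonglongrightarrow> 0"
  shows "uniform_limit A f g sequentially"
  unfolding uniform_limit_iff
proof (intro allI impI)
  fix e :: real assume e: "e > 0"
  then have "\<forall>\<^sub>F n in sequentially. holder_norm \<eta> A (\<lambda>y. f n y - g y) < ennreal e"
    using assms by (intro order_tendstoD) auto
  then show "\<forall>\<^sub>F n in sequentially. \<forall>y\<in>A. dist (f n y) (g y) < e"
  proof eventually_elim
    case (elim n)
    have "ennreal (dist (f n y) (g y)) < ennreal e" if "y \<in> A" for y
      using holder_norm_ge_norm[OF that] elim unfolding dist_norm by (rule le_less_trans)
    then show ?case by (simp add: ennreal_less_iff)
  qed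
qed

section \<open>Preserved measures under a roof\<close>

text \<open>The measure-theoretic core of the setting. The bound \<open>1\<close> on the roof is matched to the time-one map:
  an orbit of length \<open>1\<close> crosses at most one roof.\<close>

locale roof_over_preserved_measure = prob_space \<mu> for \<mu> :: "'a measure" +
  fixes F :: "'a \<Rightarrow> 'a" and \<phi> :: "'a \<Rightarrow> real"
  assumes F_measurable [measurable]: "F \<in> measurable \<mu> \<mu>"
    and F_preserves: "distr \<mu> \<mu> F = \<mu>"
    and roof_integrable: "integrable \<mu> \<phi>"
    and roof_ge_1: "\<And>y. y \<in> space \<mu> \<Longrightarrow> 1 \<le> \<phi> y"
begin

sublocale pair_sigma_finite \<mu> lborel ..

abbreviation S where "S \<equiv> suspension (space \<mu>) \<phi>"
abbreviation \<mu>\<phi> where "\<mu>\<phi> \<equiv> suspension_measure (space \<mu>) \<mu> \<phi>"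

lemma roof_measurable [measurable]: "\<phi> \<in> borel_measurable \<mu>"
  using roof_integrable by auto

lemma suspension_sets [measurable]: "S \<in> sets (\<mu> \<Otimes>\<^sub>M lborel)"
proof -
  have "S = {x \<in> space (\<mu> \<Otimes>\<^sub>M lborel). 0 \<le> snd x \<and> snd x < \<phi> (fst x)}"
    by (auto simp: suspension_def space_pair_measure)
  also have "\<dots> \<in> sets (\<mu> \<Otimes>\<^sub>M lborel)" by measurable
  finally show ?thesis .
qed

lemma suspension_Int_sets: "S \<inter> space (\<mu> \<Otimes>\<^sub>M lborel) \<in> sets (\<mu> \<Otimes>\<^sub>M lborel)"
  by measurable

lemma roof_mean_pos: "0 < (\<integral>y. \<phi> y \<partial>\<mu>)"
proof -
  have "(\<integral>y. 1 \<partial>\<mu>) \<le> (\<integral>y. \<phi> y \<partial>\<mu>)"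
    by (intro integral_mono roof_integrable roof_ge_1) auto
  then show ?thesis by (simp add: prob_space)
qed

text \<open>The mean of \<open>\<phi>\<close> is a positive real, so its inverse in \<open>[0,\<infinity>]\<close> is a positive real as well, and
  the scaled measure has a constant real density. This gives access to the integration rules for
  densities.\<close>

lemma suspension_measure_eq_density:
  "\<mu>\<phi> = density (restrict_space (\<mu> \<Otimes>\<^sub>M lborel) S) (\<lambda>_. ennreal (1 / (\<integral>y. \<phi> y \<partial>\<mu>)))"
  using roof_mean_pos unfolding suspension_measure_def
  by (intro measure_eqI) (auto simp: emeasure_density_const inverse_ennreal inverse_eq_divide)

lemma AE_suspension_measure_iff:
  "(AE x in \<mu>\<phi>. P x) \<longleftrightarrow> (AE x in \<mu> \<Otimes>\<^sub>M lborel. x \<in> S \<longrightarrow> P x)"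
  using roof_mean_pos unfolding suspension_measure_eq_density
  by (subst AE_density) (auto simp: AE_restrict_space_iff[OF suspension_Int_sets])

lemma borel_measurable_suspension_measure_iff:
  fixes f :: "'a \<times> real \<Rightarrow> 'b::real_normed_vector"
  shows "f \<in> borel_measurable \<mu>\<phi> \<longleftrightarrow> (\<lambda>x. indicator S x *\<^sub>R f x) \<in> borel_measurable (\<mu> \<Otimes>\<^sub>M lborel)"
  unfolding suspension_measure_eq_density by (simp add: borel_measurable_restrict_space_iff[OF suspension_Int_sets])

lemma integrable_suspension_measureI:
  fixes f :: "'a \<times> real \<Rightarrow> real"
  assumes "integrable (\<mu> \<Otimes>\<^sub>M lborel) (\<lambda>x. indicator S x * f x)"
  shows "integrable \<mu>\<phi> f"
proof -
  have i: "integrable (restrict_space (\<mu> \<Otimes>\<^sub>M lborel) S) f"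
    using assms by (simp add: integrable_restrict_space[OF suspension_Int_sets])
  then show ?thesis 
    unfolding suspension_measure_eq_density using roof_mean_pos
    by (subst integrable_density) (auto dest: borel_measurable_integrable)
qed

lemma integral_suspension_measure:
  fixes f :: "'a \<times> real \<Rightarrow> real"
  assumes "integrable (\<mu> \<Otimes>\<^sub>M lborel) (\<lambda>x. indicator S x * f x)"
  shows "(\<integral>x. f x \<partial>\<mu>\<phi>) = (\<integral>x. indicator S x * f x \<partial>(\<mu> \<Otimes>\<^sub>M lborel)) / (\<integral>y. \<phi> y \<partial>\<mu>)"
proof -
  have i: "integrable (restrict_space (\<mu> \<Otimes>\<^sub>M lborel) S) f"
    using assms by (simp add: integrable_restrict_space[OF suspension_Int_sets])
  then show ?thesis 
    unfolding suspension_measure_eq_density using roof_mean_pos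
    by (subst integral_density) (auto dest: borel_measurable_integrable simp: integral_restrict_space[OF suspension_Int_sets])
qed

lemma AE_compose_base_map: "AE y in \<mu>. P y \<Longrightarrow> AE y in \<mu>. P (F y)"
  using AE_distrD[OF F_measurable, of P] unfolding F_preserves .

text \<open>A null set of base points carries a null set of fibres. Passing to a measurable null set avoids any
  measurability assumption on \<open>P\<close>.\<close>

lemma AE_suspension_measure_base:
  assumes "AE y in \<mu>. P y"
  shows "AE x in \<mu>\<phi>. P (fst x)"
proof -
  obtain N where N: "N \<in> null_sets \<mu>" "{y \<in> space \<mu>. \<not> P y} \<subseteq> N"
    using assms by (auto simp: eventually_ae_filter)
  have [measurable]: "N \<in> sets \<mu>" using N(1) by auto
  have "AE x in \<mu> \<Otimes>\<^sub>M lborel. fst x \<notin> N"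
  proof (rule AE_pair_measure)
    show "{x \<in> space (\<mu> \<Otimes>\<^sub>M lborel). fst x \<notin> N} \<in> sets (\<mu> \<Otimes>\<^sub>M lborel)" by measurable
  qed (use AE_not_in[OF N(1)] in auto)
  then show ?thesis
    unfolding AE_suspension_measure_iff
    by eventually_elim (use N(2) in \<open>auto simp: suspension_def\<close>)
qed

text \<open>An essentially bounded function may be unbounded, or not integrable, on a null set of fibres;
  by Fubini's theorem almost every fibre is harmless.\<close>

lemma in_Lp_infinity_suspension_fibres:
  fixes h :: "'a \<times> real \<Rightarrow> 'b::{banach, second_countable_topology}"
  assumes "in_Lp \<infinity> \<mu>\<phi> h"
  obtains c where "0 \<le> c"
    "AE y in \<mu>. set_integrable lborel {0..<\<phi> y} (\<lambda>u. h (y, u)) \<and>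
      (AE u in lborel. u \<in> {0..<\<phi> y} \<longrightarrow> norm (h (y, u)) \<le> c)"
proof -
  obtain c where c: "0 \<le> c" "AE x in \<mu>\<phi>. norm (h x) \<le> c" and "h \<in> borel_measurable \<mu>\<phi>"
    using assms unfolding in_Lp_infinity_iff by blast
  then have [measurable]: "(\<lambda>x. indicator S x *\<^sub>R h x) \<in> borel_measurable (\<mu> \<Otimes>\<^sub>M lborel)"
    by (simp add: borel_measurable_suspension_measure_iff)
  have "AE y in \<mu>. AE u in lborel. (y, u) \<in> S \<longrightarrow> norm (h (y, u)) \<le> c"
    using c(2) unfolding AE_suspension_measure_iff by (rule AE_pair)
  then have "AE y in \<mu>. set_integrable lborel {0..<\<phi> y} (\<lambda>u. h (y, u)) \<and>
      (AE u in lborel. u \<in> {0..<\<phi> y} \<longrightarrow> norm (h (y, u)) \<le> c)"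
    using AE_space
  proof eventually_elim
    case (elim y)
    have slice: "indicator S (y, u) *\<^sub>R h (y, u) = indicator {0..<\<phi> y} u *\<^sub>R h (y, u)" for u
      using elim(2) by (auto simp: suspension_def indicator_def)
    have "(\<lambda>u. indicator S (y, u) *\<^sub>R h (y, u)) \<in> borel_measurable lborel"
      using elim(2) by measurable
    then have m: "(\<lambda>u. indicator {0..<\<phi> y} u *\<^sub>R h (y, u)) \<in> borel_measurable lborel"
      unfolding slice .
    have b: "AE u in lborel. u \<in> {0..<\<phi> y} \<longrightarrow> norm (h (y, u)) \<le> c"
      using elim by (auto simp: suspension_def)
    have "integrable lborel (\<lambda>u. indicator {0..<\<phi> y} u *\<^sub>R h (y, u))"
    proof (rule integrableI_bounded_set[OF _ m])
      show "AE u in lborel. u \<in> {0..<\<phi> y} \<longrightarrow> norm (indicator {0..<\<phi> y} u *\<^sub>R h (y, u)) \<le> c"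
        using b by eventually_elim auto
    qed (use roof_ge_1[OF elim(2)] in auto)
    then show ?case using b by (simp add: set_integrable_def)
  qed
  then show ?thesis using c(1) that by blast
qed


text \<open>With \<open>w k = P^k v'\<close> the lemma says \<open>P m' = 0\<close>. Tested against \<open>h\<close>, the duality
  \<open>\<integral> (P f) h = \<integral> f (h \<circ> F)\<close> shifts the index of the partial sums: the integral of
  \<open>(w 0 + \<dots> + w n) (h \<circ> F)\<close> is that of \<open>(w 1 + \<dots> + w (n + 1)) h\<close>. In the limit
  \<open>\<integral> (v' + chi') (h \<circ> F) = \<integral> chi' h\<close>, and by invariance the right-hand side is
  \<open>\<integral> (chi' \<circ> F) (h \<circ> F)\<close>. Uniform convergence makes \<open>chi'\<close> integrable and justifies the limits.\<close>

lemma martingale_base_transfer_zero: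
  fixes w :: "nat \<Rightarrow> 'a \<Rightarrow> real^'n"
  assumes w: "\<And>k. is_transfer_vec \<mu> F (w k) (w (Suc k))"
    and lim: "uniform_limit (space \<mu>) (\<lambda>n y. \<Sum>k=1..n. w k y) chi' sequentially"
  shows "is_transfer_vec \<mu> F (martingale_base F (w 0) chi') (\<lambda>_. 0)"
  unfolding is_transfer_vec_def
proof
  fix i
  define a where "a k y = w k y $ i" for k y
  define ps where "ps n y = (\<Sum>k=1..n. a k y)" for n y
  define x where "x y = chi' y $ i" for y
  have tr: "is_transfer \<mu> F (a k) (a (Suc k))" for k
    using w[of k] unfolding is_transfer_vec_def a_def by blast
  have a_int: "integrable \<mu> (a k)" for k using tr by (auto simp: is_transfer_def)
  then have ps_int: "integrable \<mu> (ps n)" for n unfolding ps_def by simp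
  have close: "\<exists>N. \<forall>n\<ge>N. \<forall>y\<in>space \<mu>. \<bar>ps n y - x y\<bar> < e" if "e > 0" for e
  proof -
    obtain N where N: "\<And>n y. n \<ge> N \<Longrightarrow> y \<in> space \<mu> \<Longrightarrow> norm ((\<Sum>k=1..n. w k y) - chi' y) < e"
      using lim \<open>e > 0\<close> unfolding uniform_limit_sequentially_iff dist_norm by meson
    have "\<bar>ps n y - x y\<bar> \<le> norm ((\<Sum>k=1..n. w k y) - chi' y)" for n y
      using component_le_norm_cart[of "(\<Sum>k=1..n. w k y) - chi' y" i]
      by (simp add: ps_def x_def a_def)
    then show ?thesis using N by (meson le_less_trans)
  qed
  have ps_lim: "(\<lambda>n. ps n y) \<longlonglongrightarrow> x y" if "y \<in> space \<mu>" for y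
    unfolding LIMSEQ_def dist_real_def using close that by blast
  have [measurable]: "ps n \<in> borel_measurable \<mu>" for n using ps_int by auto
  have [measurable]: "x \<in> borel_measurable \<mu>"
    by (rule borel_measurable_LIMSEQ_metric[OF _ ps_lim]) measurable
  obtain N where N: "\<And>n y. n \<ge> N \<Longrightarrow> y \<in> space \<mu> \<Longrightarrow> \<bar>ps n y - x y\<bar> < 1"
    using close[of 1] by auto
  have x_int: "integrable \<mu> x"
  proof (rule Bochner_Integration.integrable_bound[of \<mu> "\<lambda>y. \<bar>ps N y\<bar> + 1"])
    have "\<bar>x y\<bar> \<le> \<bar>ps N y\<bar> + 1" if "y \<in> space \<mu>" for y
      using N[OF order_refl that] by linarith
    then show "AE y in \<mu>. norm (x y) \<le> norm (\<bar>ps N y\<bar> + 1)" by auto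
  qed (use ps_int in auto)
  \<comment> \<open>From the index \<open>N\<close> on, the partial sums are dominated by \<open>\<bar>x\<bar> + 1\<close>.\<close>
  have lim_test: "(\<lambda>n. \<integral>y. ps n y * h y \<partial>\<mu>) \<longlonglongrightarrow> (\<integral>y. x y * h y \<partial>\<mu>)" if h: "in_Lp \<infinity> \<mu> h" for h
  proof (rule LIMSEQ_offset)
    have [measurable]: "h \<in> borel_measurable \<mu>" using h by (simp add: in_Lp_def)
    show "(\<lambda>n. \<integral>y. ps (n + N) y * h y \<partial>\<mu>) \<longlonglongrightarrow> (\<integral>y. x y * h y \<partial>\<mu>)"
    proof (rule integral_dominated_convergence)
      show "integrable \<mu> (\<lambda>y. \<bar>(\<bar>x y\<bar> + 1) * h y\<bar>)"
        using x_int by (intro integrable_abs in_Lp_infinity_mult_integrable[OF _ h]) auto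
      show "AE y in \<mu>. norm (ps (n + N) y * h y) \<le> \<bar>(\<bar>x y\<bar> + 1) * h y\<bar>" for n
      proof (rule AE_I2)
        fix y assume "y \<in> space \<mu>"
        then have "\<bar>ps (n + N) y\<bar> \<le> \<bar>x y\<bar> + 1" using N[of "n + N" y] by linarith
        then show "norm (ps (n + N) y * h y) \<le> \<bar>(\<bar>x y\<bar> + 1) * h y\<bar>"
          by (auto simp: abs_mult intro!: mult_right_mono)
      qed
      show "AE y in \<mu>. (\<lambda>n. ps (n + N) y * h y) \<longlonglongrightarrow> x y * h y"
        using ps_lim by (intro AE_I2 tendsto_mult_right LIMSEQ_ignore_initial_segment) auto
    qed measurable
  qed
  have xF_int: "integrable \<mu> (\<lambda>y. x (F y))"
    using integrable_distr[OF F_measurable, of x] x_int by (simp add: F_preserves)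
  have m_eq: "martingale_base F (w 0) chi' y $ i = a 0 y - x (F y) + x y" for y
    by (simp add: martingale_base_def a_def x_def)
  have "(\<integral>y. (a 0 y - x (F y) + x y) * h (F y) \<partial>\<mu>) = 0" if h: "in_Lp \<infinity> \<mu> h" for h
  proof -
    have [measurable]: "h \<in> borel_measurable \<mu>" using h by (simp add: in_Lp_def)
    have hF: "in_Lp \<infinity> \<mu> (\<lambda>y. h (F y))"
      using h AE_compose_base_map unfolding in_Lp_infinity_iff by fastforce
    have test: "integrable \<mu> (\<lambda>y. a k y * h y)" "integrable \<mu> (\<lambda>y. a k y * h (F y))"
      "(\<integral>y. a (Suc k) y * h y \<partial>\<mu>) = (\<integral>y. a k y * h (F y) \<partial>\<mu>)" for k
      using in_Lp_infinity_mult_integrable[OF a_int] h hF tr[of k] by (auto simp: is_transfer_def)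
    have "(\<integral>y. a 0 y * h (F y) \<partial>\<mu>) + (\<integral>y. ps n y * h (F y) \<partial>\<mu>) = (\<integral>y. ps (Suc n) y * h y \<partial>\<mu>)" for n
    proof (induction n)
      case 0
      then show ?case using test(3)[of 0] by (simp add: ps_def)
    next
      case (Suc n)
      have "(\<integral>y. ps (Suc n) y * g y \<partial>\<mu>) = (\<integral>y. ps n y * g y \<partial>\<mu>) + (\<integral>y. a (Suc n) y * g y \<partial>\<mu>)"
        if "in_Lp \<infinity> \<mu> g" for n g
        using in_Lp_infinity_mult_integrable[OF a_int that] in_Lp_infinity_mult_integrable[OF ps_int that]
        by (simp add: ps_def distrib_right)
      from this[OF hF, of n] this[OF h, of "Suc n"] Suc test(3)[of "Suc n"] show ?case by simp
    qed
    moreover have "(\<lambda>n. (\<integral>y. a 0 y * h (F y) \<partial>\<mu>) + (\<integral>y. ps n y * h (F y) \<partial>\<mu>))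
        \<longlonglongrightarrow> (\<integral>y. a 0 y * h (F y) \<partial>\<mu>) + (\<integral>y. x y * h (F y) \<partial>\<mu>)"
      by (intro tendsto_add tendsto_const lim_test hF)
    moreover have "(\<lambda>n. \<integral>y. ps (Suc n) y * h y \<partial>\<mu>) \<longlonglongrightarrow> (\<integral>y. x y * h y \<partial>\<mu>)"
      using lim_test[OF h] by (rule LIMSEQ_Suc)
    ultimately have "(\<integral>y. a 0 y * h (F y) \<partial>\<mu>) + (\<integral>y. x y * h (F y) \<partial>\<mu>) = (\<integral>y. x y * h y \<partial>\<mu>)"
      using LIMSEQ_unique by simp
    also have "(\<integral>y. x y * h y \<partial>\<mu>) = (\<integral>y. x (F y) * h (F y) \<partial>\<mu>)"
      using integral_distr[OF F_measurable, of "\<lambda>y. x y * h y"] by (simp add: F_preserves)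
    finally show ?thesis
      using test(2)[of 0] in_Lp_infinity_mult_integrable[OF x_int hF] in_Lp_infinity_mult_integrable[OF xF_int hF]
      by (simp add: distrib_right left_diff_distrib)
  qed
  moreover have "integrable \<mu> (\<lambda>y. a 0 y - x (F y) + x y)"
    using a_int x_int xF_int by simp
  ultimately show "is_transfer \<mu> F (\<lambda>y. martingale_base F (w 0) chi' y $ i) (\<lambda>_. 0 $ i)"
    unfolding is_transfer_def m_eq by simp
qed

text \<open>Integration over the strip below the roof, in which every fibre has length \<open>1\<close>. For this reason an
  essentially bounded weight \<open>k\<close> keeps the product with \<open>b\<close> integrable, however long the fibres are.\<close>

lemma top_strip_Fubini:
  fixes b :: "'a \<Rightarrow> real" and k :: "'a \<times> real \<Rightarrow> real"
  assumes b: "integrable \<mu> b" and k [measurable]: "k \<in> borel_measurable (\<mu> \<Otimes>\<^sub>M lborel)"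
    and bound: "AE y in \<mu>. AE u in lborel. u \<in> {\<phi> y - 1..<\<phi> y} \<longrightarrow> \<bar>k (y, u)\<bar> \<le> c"
  defines "f \<equiv> \<lambda>(y, u). indicator {\<phi> y - 1..<\<phi> y} u * (b y * k (y, u))"
  shows "integrable (\<mu> \<Otimes>\<^sub>M lborel) f"
    and "(\<integral>x. f x \<partial>(\<mu> \<Otimes>\<^sub>M lborel)) = (\<integral>y. b y * (LBINT u:{\<phi> y - 1..<\<phi> y}. k (y, u)) \<partial>\<mu>)"
proof -
  have [measurable]: "b \<in> borel_measurable \<mu>" using b by auto
  have f_meas [measurable]: "f \<in> borel_measurable (\<mu> \<Otimes>\<^sub>M lborel)"
  proof -
    let ?Z = "{x \<in> space (\<mu> \<Otimes>\<^sub>M lborel). \<phi> (fst x) - 1 \<le> snd x \<and> snd x < \<phi> (fst x)}"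
    have Z: "?Z \<in> sets (\<mu> \<Otimes>\<^sub>M lborel)" by measurable
    have b_fst: "(\<lambda>x. b (fst x)) \<in> borel_measurable (\<mu> \<Otimes>\<^sub>M lborel)" by measurable
    have "(\<lambda>x. indicator ?Z x * (b (fst x) * k x)) \<in> borel_measurable (\<mu> \<Otimes>\<^sub>M lborel)"
      by (rule borel_measurable_times[OF borel_measurable_indicator[OF Z] borel_measurable_times[OF b_fst k]])
    also have "?this \<longleftrightarrow> ?thesis"
      by (intro measurable_cong) (auto simp: f_def indicator_def)
    finally show ?thesis .
  qed
  have fibre: "AE y in \<mu>. integrable lborel (\<lambda>u. f (y, u)) \<and> norm (\<integral>u. norm (f (y, u)) \<partial>lborel) \<le> norm (c * \<bar>b y\<bar>)"
    using bound AE_space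
  proof eventually_elim
    case (elim y)
    have "(\<lambda>u. k (y, u)) \<in> borel_measurable lborel" using elim(2) by measurable
    note I = set_integral_unit_interval[OF this _ elim(1)] and
      J = set_integral_unit_interval[of "\<lambda>u. \<bar>k (y, u)\<bar>" "\<phi> y" "\<phi> y - 1" c, OF borel_measurable_abs[OF this]]
    have "integrable lborel (\<lambda>u. b y * (indicator {\<phi> y - 1..<\<phi> y} u *\<^sub>R k (y, u)))"
      using I(1) unfolding set_integrable_def by (intro integrable_mult_right) auto
    then have "integrable lborel (\<lambda>u. f (y, u))" by (simp add: f_def mult_ac)
    moreover have "(\<integral>u. norm (f (y, u)) \<partial>lborel) = \<bar>b y\<bar> * (LBINT u:{\<phi> y - 1..<\<phi> y}. \<bar>k (y, u)\<bar>)"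
      unfolding set_lebesgue_integral_def f_def
      by (subst integral_mult_right_zero[symmetric]) (auto simp: abs_mult mult_ac)
    moreover have "\<bar>LBINT u:{\<phi> y - 1..<\<phi> y}. \<bar>k (y, u)\<bar>\<bar> \<le> c" 
      using elim(1) by (intro J(2)) auto
    ultimately show ?case
      by (auto simp: abs_mult mult.commute[of c] intro!: mult_left_mono)
  qed
  have [measurable]: "(\<lambda>y. \<integral>u. norm (f (y, u)) \<partial>lborel) \<in> borel_measurable \<mu>" by measurable
  show int: "integrable (\<mu> \<Otimes>\<^sub>M lborel) f"
  proof (rule Fubini_integrable[OF f_meas])
    show "integrable \<mu> (\<lambda>y. \<integral>u. norm (f (y, u)) \<partial>lborel)"
      by (rule Bochner_Integration.integrable_bound[of \<mu> "\<lambda>y. c * \<bar>b y\<bar>"]) (use b fibre in auto)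
  qed (use fibre in auto)
  have "(\<integral>u. f (y, u) \<partial>lborel) = b y * (LBINT u:{\<phi> y - 1..<\<phi> y}. k (y, u))" for y
    unfolding set_lebesgue_integral_def f_def
    by (subst integral_mult_right_zero[symmetric]) (auto simp: mult_ac)
  then show "(\<integral>x. f x \<partial>(\<mu> \<Otimes>\<^sub>M lborel)) = (\<integral>y. b y * (LBINT u:{\<phi> y - 1..<\<phi> y}. k (y, u)) \<partial>\<mu>)"
    using integral_fst'[OF int] by simp
qed

text \<open>If \<open>P b = 0\<close> on the base, then \<open>b\<close> spread over the strip below the roof is in the kernel of
  \<open>L_1\<close>: the time-one map sends the strip over \<open>y\<close> onto \<open>[0, 1)\<close> over \<open>F y\<close>, so a test function on the
  suspension is seen by \<open>b\<close> only through its mean \<open>G\<close> over \<open>[0, 1)\<close>.\<close>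

lemma transfer_zero_top_strip:
  assumes b: "is_transfer \<mu> F b (\<lambda>_. 0)"
  shows "is_transfer \<mu>\<phi> (suspension_flow F \<phi> 1)
    (\<lambda>(y, u). if \<phi> y - 1 \<le> u \<and> u < \<phi> y then b y else 0) (\<lambda>_. 0)"
    (is "is_transfer _ _ ?q _")
proof -
  have b_int: "integrable \<mu> b" and b_test: "\<And>h. in_Lp \<infinity> \<mu> h \<Longrightarrow> (\<integral>y. b y * h (F y) \<partial>\<mu>) = 0"
    using b by (auto simp: is_transfer_def)
  have on_S: "indicator S x * (?q x * k) = (case x of (y, u) \<Rightarrow> indicator {\<phi> y - 1..<\<phi> y} u * (b y * k))"
    if "x \<in> space (\<mu> \<Otimes>\<^sub>M lborel)" for x k
    using that roof_ge_1[of "fst x"]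
    by (auto simp: suspension_def space_pair_measure indicator_def split: prod.splits)
  have q_int: "integrable \<mu>\<phi> ?q"
  proof (rule integrable_suspension_measureI)
    have "integrable (\<mu> \<Otimes>\<^sub>M lborel) (\<lambda>(y, u). indicator {\<phi> y - 1..<\<phi> y} u * (b y * 1))"
      by (rule top_strip_Fubini(1)[OF b_int, of "\<lambda>_. 1" 1]) auto
    then show "integrable (\<mu> \<Otimes>\<^sub>M lborel) (\<lambda>x. indicator S x * ?q x)"
      using on_S[of _ 1] by (subst Bochner_Integration.integrable_cong[OF refl]) auto
  qed
  have "(\<integral>x. ?q x * g (suspension_flow F \<phi> 1 x) \<partial>\<mu>\<phi>) = 0" if g: "in_Lp \<infinity> \<mu>\<phi> g" for g :: "'a \<times> real \<Rightarrow> real"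
  proof -
    obtain c where c: "0 \<le> c"
      and "AE y in \<mu>. set_integrable lborel {0..<\<phi> y} (\<lambda>u. g (y, u)) \<and>
        (AE u in lborel. u \<in> {0..<\<phi> y} \<longrightarrow> norm (g (y, u)) \<le> c)"
      by (rule in_Lp_infinity_suspension_fibres[OF g])
    then have g_bound: "AE y in \<mu>. AE u in lborel. u \<in> {0..<\<phi> y} \<longrightarrow> norm (g (y, u)) \<le> c"
      by auto
    \<comment> \<open>The test function is measurable on the suspension only, so it is extended by \<open>0\<close>. For
      \<open>(y, u)\<close> in the strip, \<open>k (y, u)\<close> is its value at the image under the time-one map.\<close>
    define g0 where "g0 x = indicator S x * g x" for x
    have [measurable]: "g0 \<in> borel_measurable (\<mu> \<Otimes>\<^sub>M lborel)"
      using g by (simp add: in_Lp_def borel_measurable_suspension_measure_iff g0_def[abs_def])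
    define k where "k = (\<lambda>(y, u). g0 (F y, u + 1 - \<phi> y))"
    have [measurable]: "k \<in> borel_measurable (\<mu> \<Otimes>\<^sub>M lborel)"
      unfolding k_def by measurable
    define G where "G y = (LBINT u:{0..<1}. g0 (y, u))" for y
    have g0_bound: "AE y in \<mu>. AE u in lborel. u \<in> {0..<1} \<longrightarrow> \<bar>g0 (y, u)\<bar> \<le> c"
      using g_bound AE_space
    proof eventually_elim
      case (elim y)
      from elim(1) show ?case
        by eventually_elim (use c roof_ge_1[OF elim(2)] in \<open>auto simp: g0_def indicator_def\<close>)
    qed
    have G: "in_Lp \<infinity> \<mu> G"
      unfolding in_Lp_infinity_iff
    proof (intro conjI exI)
      show "G \<in> borel_measurable \<mu>"
        unfolding G_def set_lebesgue_integral_def by measurable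
      show "AE y in \<mu>. norm (G y) \<le> c"
        using g0_bound AE_space
      proof eventually_elim
        case (elim y)
        have "(\<lambda>u. g0 (y, u)) \<in> borel_measurable lborel" using elim(2) by measurable
        from set_integral_unit_interval(2)[OF this _ elim(1)] show ?case
          by (simp add: G_def)
      qed
    qed (fact c)
    \<comment> \<open>The bound on \<open>g\<close> holds almost everywhere only; it survives composition with the time-one
      map because \<open>F\<close> and translations of the fibre coordinate preserve null sets.\<close>
    have k_bound: "AE y in \<mu>. AE u in lborel. u \<in> {\<phi> y - 1..<\<phi> y} \<longrightarrow> \<bar>k (y, u)\<bar> \<le> c"
      using AE_compose_base_map[OF g0_bound]
    proof eventually_elim
      case (elim y)
      have "AE u in distr lborel borel ((+) (1 - \<phi> y)). u \<in> {0..<1} \<longrightarrow> \<bar>g0 (F y, u)\<bar> \<le> c"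
        using elim unfolding lborel_distr_plus .
      then have "AE u in lborel. 1 - \<phi> y + u \<in> {0..<1} \<longrightarrow> \<bar>g0 (F y, 1 - \<phi> y + u)\<bar> \<le> c"
        by (rule AE_distrD[rotated]) simp
      then show ?case
        by eventually_elim (auto simp: k_def algebra_simps)
    qed
    have k_fibre: "(LBINT u:{\<phi> y - 1..<\<phi> y}. k (y, u)) = G (F y)" for y
      unfolding G_def by (intro set_integral_lborel_translate[of _ "1 - \<phi> y"]) (auto simp: k_def algebra_simps)
    have integrand: "indicator S x * (?q x * g (suspension_flow F \<phi> 1 x)) =
        (case x of (y, u) \<Rightarrow> indicator {\<phi> y - 1..<\<phi> y} u * (b y * k (y, u)))"
      if x: "x \<in> space (\<mu> \<Otimes>\<^sub>M lborel)" for x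
    proof -
      obtain y u where [simp]: "x = (y, u)" by (cases x)
      have "F y \<in> space \<mu>" using x measurable_space[OF F_measurable] by (auto simp: space_pair_measure)
      then have "g (suspension_flow F \<phi> 1 (y, u)) = k (y, u)" if "u \<in> {\<phi> y - 1..<\<phi> y}"
        using that roof_ge_1[of "F y"]
        by (subst suspension_flow_past_roof) (auto simp: k_def g0_def suspension_def indicator_def)
      then show ?thesis unfolding on_S[OF x] by (auto simp: indicator_def)
    qed
    note strip = top_strip_Fubini[OF b_int \<open>k \<in> _\<close> k_bound]
    have "integrable (\<mu> \<Otimes>\<^sub>M lborel) (\<lambda>x. indicator S x * (?q x * g (suspension_flow F \<phi> 1 x)))"
      using strip(1) integrand by (subst Bochner_Integration.integrable_cong[OF refl]) auto
    then have "(\<integral>x. ?q x * g (suspension_flow F \<phi> 1 x) \<partial>\<mu>\<phi>) =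
        (\<integral>x. indicator S x * (?q x * g (suspension_flow F \<phi> 1 x)) \<partial>(\<mu> \<Otimes>\<^sub>M lborel)) / (\<integral>y. \<phi> y \<partial>\<mu>)"
      by (rule integral_suspension_measure)
    also have "(\<integral>x. indicator S x * (?q x * g (suspension_flow F \<phi> 1 x)) \<partial>(\<mu> \<Otimes>\<^sub>M lborel)) =
        (\<integral>x. (case x of (y, u) \<Rightarrow> indicator {\<phi> y - 1..<\<phi> y} u * (b y * k (y, u))) \<partial>(\<mu> \<Otimes>\<^sub>M lborel))"
      using integrand by (intro Bochner_Integration.integral_cong) auto
    also have "\<dots> = (\<integral>y. b y * G (F y) \<partial>\<mu>)"
      using strip(2) by (simp add: k_fibre)
    also have "\<dots> = 0" using b_test[OF G] .
    finally show ?thesis by simp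
  qed
  then show ?thesis using q_int by (simp add: is_transfer_def)
qed

end

section \<open>The roof of a nonuniformly expanding semiflow\<close>

text \<open>The return time \<open>r\<close> is measurable because it is Hoelder continuous.\<close>

lemma finite_holder_norm_imp_continuous_on:
  fixes w :: "'a::metric_space \<Rightarrow> 'b::real_normed_vector"
  assumes fin: "holder_norm \<eta> A w < \<infinity>" and \<eta>: "0 < \<eta>"
  shows "continuous_on A w"
proof -
  obtain H where H: "holder_norm \<eta> A w = ennreal H" "0 \<le> H"
    using fin by (auto simp: less_top_ennreal)
  have holder: "norm (w z - w x) \<le> H * dist z x powr \<eta>" if "x \<in> A" "z \<in> A" for x z
  proof (cases "z = x")
    case False
    let ?q = "\<lambda>(y, y'). ennreal (norm (w y - w y') / dist y y' powr \<eta>)"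
    have "?q (z, x) \<le> (SUP yy' \<in> {(y, y'). y \<in> A \<and> y' \<in> A \<and> y \<noteq> y'}. ?q yy')"
      by (rule SUP_upper) (use that False in simp)
    also have "\<dots> \<le> holder_norm \<eta> A w"
      unfolding holder_norm_def by (rule add_increasing) simp_all
    finally have "norm (w z - w x) / dist z x powr \<eta> \<le> H"
      using H by (simp add: ennreal_le_iff)
    then show ?thesis using False by (simp add: pos_divide_le_eq)
  qed simp
  show ?thesis
    unfolding continuous_on_def
  proof
    fix x assume x: "x \<in> A"
    have "((\<lambda>z. dist z x) \<longlongrightarrow> 0) (at x within A)"
      by (rule tendsto_dist_iff[THEN iffD1, OF tendsto_ident_at])
    then have "((\<lambda>z. dist z x powr \<eta>) \<longlongrightarrow> 0) (at x within A)"
      using \<eta> by (intro tendsto_zero_powrI[where b = \<eta>]) simp_all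
    then have lim: "((\<lambda>z. H * dist z x powr \<eta>) \<longlongrightarrow> 0) (at x within A)"
      by (rule tendsto_mult_right_zero)
    have "\<forall>\<^sub>F z in at x within A. norm (w z - w x) \<le> H * dist z x powr \<eta>"
      using holder[OF x] by (simp add: eventually_at_filter)
    then have "((\<lambda>z. w z - w x) \<longlongrightarrow> 0) (at x within A)"
      using lim by (rule Lim_null_comparison)
    then show "(w \<longlongrightarrow> w x) (at x within A)" by (rule Lim_null[THEN iffD2])
  qed
qed

lemma (in sigma_finite_measure) integrable_if_bounded_RN_deriv:
  fixes f :: "'a \<Rightarrow> 'b::{banach, second_countable_topology}"
  assumes ac: "absolutely_continuous M N" and sets: "sets N = sets M"
    and bound: "AE x in M. RN_deriv M N x \<le> ennreal c" and f: "integrable M f"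
  shows "integrable N f"
proof -
  have N: "N = density M (RN_deriv M N)" using density_RN_deriv[OF ac sets] by simp
  have [measurable]: "f \<in> borel_measurable M" using f by auto
  have "(\<integral>\<^sup>+x. ennreal (norm (f x)) \<partial>N) = (\<integral>\<^sup>+x. RN_deriv M N x * ennreal (norm (f x)) \<partial>M)"
    by (subst N, subst nn_integral_density) auto
  also have "\<dots> \<le> (\<integral>\<^sup>+x. ennreal c * ennreal (norm (f x)) \<partial>M)"
    by (intro nn_integral_mono_AE eventually_mono[OF bound] mult_right_mono) simp_all
  also have "\<dots> < \<infinity>"
    using f by (auto simp: nn_integral_cmult integrable_iff_bounded ennreal_mult_less_top)
  finally have "(\<integral>\<^sup>+x. ennreal (norm (f x)) \<partial>N) < \<infinity>" .
  moreover have "f \<in> borel_measurable N"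
    using borel_measurable_integrable[OF f] unfolding measurable_cong_sets[OF sets refl] .
  ultimately show ?thesis by (simp add: integrable_iff_bounded)
qed

context nonuniformly_expanding_semiflow
begin

lemma space_rho: "space \<rho> = X"
  using sets_eq_imp_space_eq[OF rho_sets] by (simp add: space_restrict_space)

lemma Y_subset_X: "Y \<subseteq> X"
  using sets.sets_into_space[OF Y_sets] by (simp add: space_rho)

lemma space_acip:
  assumes "acip_bounded_density \<rho> Y F \<mu>"
  shows "space \<mu> = Y"
  using assms Y_subset_X sets_eq_imp_space_eq[of \<mu> "restrict_space \<rho> Y"]
  by (auto simp: acip_bounded_density_def space_restrict_space space_rho)

lemma T_iterates_measurable: "T ^^ j \<in> measurable \<rho> \<rho>"
  using rho_nonsingular by (intro measurable_compose_n) (auto simp: nonsingular_map_def)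

lemma T_iterates_in_X: "y \<in> Y \<Longrightarrow> (T ^^ j) y \<in> X"
  using measurable_space[OF T_iterates_measurable] Y_subset_X by (auto simp: space_rho)

lemma r_measurable: "r \<in> borel_measurable \<rho>"
proof -
  have "continuous_on X r"
    using finite_holder_norm_imp_continuous_on[OF r_holder] eta by simp
  then show ?thesis
    using borel_measurable_continuous_on_restrict measurable_cong_sets[OF rho_sets refl] by blast
qed

lemma r_bounded: obtains B where "0 \<le> B" "\<And>x. x \<in> X \<Longrightarrow> r x \<le> B"
proof -
  obtain B where B: "holder_norm \<eta> X r = ennreal B" "0 \<le> B"
    using r_holder by (cases "holder_norm \<eta> X r") auto
  have "r x \<le> B" if "x \<in> X" for x
    using holder_norm_ge_norm[OF that, of r \<eta>] B by simp
  then show ?thesis using that B(2) by blast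
qed

lemma induced_roof_ge_1:
  assumes y: "y \<in> Y"
  shows "1 \<le> induced_roof r T \<tau> y"
proof -
  have r1: "1 \<le> r ((T ^^ j) y)" for j using r_ge_1 T_iterates_in_X[OF y] .
  have "1 \<le> r ((T ^^ 0) y)" by (rule r1)
  also have "\<dots> \<le> (\<Sum>j<\<tau> y. r ((T ^^ j) y))"
    using tau_pos[OF y] r1 by (intro member_le_sum) (auto intro: order_trans[OF zero_le_one])
  finally show ?thesis by (simp add: induced_roof_def)
qed

lemma induced_roof_measurable: "induced_roof r T \<tau> \<in> borel_measurable (restrict_space \<rho> Y)"
proof -
  have [measurable]: "(\<lambda>y. real (\<tau> y)) \<in> borel_measurable (restrict_space \<rho> Y)"
    using tau_Lp by (simp add: in_Lp_def)
  have [measurable]: "(\<lambda>y. r ((T ^^ j) y)) \<in> borel_measurable (restrict_space \<rho> Y)" for j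
    by (intro measurable_restrict_space1 measurable_compose[OF T_iterates_measurable r_measurable])
  \<comment> \<open>The range of summation depends on \<open>y\<close>; a series with fixed range is measurable termwise.\<close>
  have "induced_roof r T \<tau> = (\<lambda>y. \<Sum>j. if real j < real (\<tau> y) then r ((T ^^ j) y) else 0)"
    unfolding induced_roof_def
    by (intro ext, subst suminf_finite[of "{..<\<tau> y}" for y]) auto
  also have "\<dots> \<in> borel_measurable (restrict_space \<rho> Y)" by measurable
  finally show ?thesis .
qed

lemma induced_roof_integrable: "integrable (restrict_space \<rho> Y) (induced_roof r T \<tau>)"
proof -
  interpret prob_space \<rho> by (rule rho_prob)
  interpret Y: finite_measure "restrict_space \<rho> Y"
    using finite_measure_restrict_space[OF finite_measure_axioms Y_sets] .
  obtain B where B: "0 \<le> B" "\<And>x. x \<in> X \<Longrightarrow> r x \<le> B" using r_bounded by metis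
  have tau: "integrable (restrict_space \<rho> Y) (\<lambda>y. real (\<tau> y))"
    using tau_Lp order by (intro Y.in_Lp_imp_integrable) (auto intro: order_trans[of _ 2])
  have bound: "norm (induced_roof r T \<tau> y) \<le> norm (B * real (\<tau> y))" if "y \<in> Y" for y
  proof -
    have "induced_roof r T \<tau> y \<le> (\<Sum>j<\<tau> y. B)"
      unfolding induced_roof_def by (intro sum_mono B T_iterates_in_X that)
    then show ?thesis using induced_roof_ge_1[OF that] by (simp add: mult.commute)
  qed
  have "integrable (restrict_space \<rho> Y) (\<lambda>y. B * real (\<tau> y))" using tau by simp
  then show ?thesis
    by (rule Bochner_Integration.integrable_bound[OF _ induced_roof_measurable AE_I2])
      (use bound in \<open>auto simp: space_restrict_space\<close>)
qed

lemma roof_over_acip: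
  assumes acip: "acip_bounded_density \<rho> Y F \<mu>"
  shows "roof_over_preserved_measure \<mu> F (induced_roof r T \<tau>)"
proof -
  interpret prob_space \<rho> by (rule rho_prob)
  interpret Y: finite_measure "restrict_space \<rho> Y"
    using finite_measure_restrict_space[OF finite_measure_axioms Y_sets] .
  interpret \<mu>: prob_space \<mu> using acip by (simp add: acip_bounded_density_def)
  have "integrable \<mu> (induced_roof r T \<tau>)"
    using acip induced_roof_integrable
    by (auto simp: acip_bounded_density_def intro: Y.integrable_if_bounded_RN_deriv)
  then show ?thesis
    using acip induced_roof_ge_1 space_acip[OF acip]
    by unfold_locales (auto simp: acip_bounded_density_def invariant_map_def)
qed

end

section \<open>The decomposition on the suspension\<close>

theorem proposition4p8:
  fixes \<Psi> :: "real \<Rightarrow> 'a::metric_space \<Rightarrow> 'a"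
    and \<rho> \<mu> :: "'a measure"
    and v m chi \<psi> :: "'a \<times> real \<Rightarrow> real^'n"
    and v' m' chi' :: "'a \<Rightarrow> real^'n"
    and flow :: "real \<Rightarrow> 'a \<times> real \<Rightarrow> 'a \<times> real"
  assumes "nonuniformly_expanding_semiflow \<Psi> K L X \<eta> \<rho> Y \<Y> \<tau> p lam C \<zeta> r T F"
    and "acip_bounded_density \<rho> Y F \<mu>"
    and "\<phi> = induced_roof r T \<tau>"
    and "flow = suspension_flow F \<phi>"
    and "\<mu>\<phi> = suspension_measure Y \<mu> \<phi>"
    and "condition_star \<eta> Y \<mu> F \<phi> v"
    and "v' = fibre_integral \<phi> v"
    and "transfer_series_sums \<eta> Y \<mu> F v' chi'"
    and "m' = martingale_base F v' chi'"
    and "chi = coboundary_part v chi'"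
    and "m = martingale_part \<phi> m'"
    and "\<psi> = (\<lambda>x. LBINT s:{0..1}. v (flow s x))"
  shows "(AE x in \<mu>\<phi>. \<psi> x = m x + chi (flow 1 x) - chi x) \<and>
         is_transfer_vec \<mu>\<phi> (flow 1) m (\<lambda>_. 0)"
proof -
  interpret nonuniformly_expanding_semiflow \<Psi> K L X \<eta> \<rho> Y \<Y> \<tau> p lam C \<zeta> r T F by fact
  have Y: "Y = space \<mu>" using space_acip assms(2) by simp
  interpret R: roof_over_preserved_measure \<mu> F \<phi>
    using roof_over_acip assms(2,3) by simp
  have \<mu>\<phi>: "\<mu>\<phi> = R.\<mu>\<phi>" using assms(5) Y by simp
  have decomposition: "AE x in \<mu>\<phi>. \<psi> x = m x + chi (flow 1 x) - chi x"
  proof -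
    \<comment> \<open>A base point is usable if \<open>v\<close> is integrable on its fibre and on that of its image.\<close>
    let ?good = "\<lambda>y. set_integrable lborel {0..<\<phi> y} (\<lambda>u. v (y, u))"
    have "in_Lp \<infinity> R.\<mu>\<phi> v" using assms(6) \<mu>\<phi> assms(5) by (simp add: condition_star_def)
    then obtain c where "AE y in \<mu>. ?good y \<and> (AE u in lborel. u \<in> {0..<\<phi> y} \<longrightarrow> norm (v (y, u)) \<le> c)"
      by (rule R.in_Lp_infinity_suspension_fibres)
    then have good: "AE y in \<mu>. ?good y" by auto
    have "AE x in R.\<mu>\<phi>. x \<in> R.S"
      by (simp add: R.AE_suspension_measure_iff)
    moreover note R.AE_suspension_measure_base[OF good]
      R.AE_suspension_measure_base[OF R.AE_compose_base_map[OF good]]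
    ultimately have "AE x in R.\<mu>\<phi>. \<psi> x = m x + chi (flow 1 x) - chi x"
    proof eventually_elim
      case (elim x)
      obtain y u where x: "x = (y, u)" by (cases x)
      have "y \<in> Y" "0 \<le> u" "u < \<phi> y" using elim(1) by (auto simp: x suspension_def Y)
      moreover have "1 \<le> \<phi> (F y)" using R.roof_ge_1[of "F y"] F_into[OF \<open>y \<in> Y\<close>] by (simp add: Y)
      ultimately show ?case
        using elim(2,3) time_one_integral_decomposition[of \<phi> y v F u chi'] assms(4,7,9-12)
        by (simp add: x)
    qed
    then show ?thesis unfolding \<mu>\<phi> .
  qed
  have kernel: "is_transfer_vec \<mu>\<phi> (flow 1) m (\<lambda>_. 0)"
    unfolding is_transfer_vec_def
  proof
    fix i
    obtain w where w: "w 0 = v'" "\<And>k. is_transfer_vec \<mu> F (w k) (w (Suc k))"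
      and lim: "(\<lambda>n. holder_norm \<eta> Y (\<lambda>y. (\<Sum>k=1..n. w k y) - chi' y)) \<longlonglongrightarrow> 0"
      using assms(8) unfolding transfer_series_sums_def by blast
    from lim have "uniform_limit (space \<mu>) (\<lambda>n y. \<Sum>k=1..n. w k y) chi' sequentially"
      unfolding Y by (rule holder_norm_tendsto_0_imp_uniform_limit)
    then have "is_transfer_vec \<mu> F m' (\<lambda>_. 0)"
      using R.martingale_base_transfer_zero[of w chi'] w assms(9) by simp
    then have "is_transfer \<mu> F (\<lambda>y. m' y $ i) (\<lambda>_. 0)"
      by (simp add: is_transfer_vec_def)
    then have "is_transfer R.\<mu>\<phi> (flow 1) (\<lambda>(y, u). if \<phi> y - 1 \<le> u \<and> u < \<phi> y then m' y $ i else 0) (\<lambda>_. 0)"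
      unfolding assms(4) by (rule R.transfer_zero_top_strip)
    moreover have "(\<lambda>(y, u). if \<phi> y - 1 \<le> u \<and> u < \<phi> y then m' y $ i else 0) = (\<lambda>x. m x $ i)"
      by (auto simp: assms(11) martingale_part_def)
    ultimately show "is_transfer \<mu>\<phi> (flow 1) (\<lambda>x. m x $ i) (\<lambda>_. 0 $ i)"
      by (simp add: \<mu>\<phi>)
  qed
  from decomposition kernel show ?thesis ..
qed

end
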